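(* Let $X=(x_{ij})$ be an $n\times n$ matrix of indeterminates over $\mathbb{Z}$, with $n\geqslant3$. Fix a prime $p>0$, let $\varphi_p$ be the standard $p$-derivation on $S=\mathbb{Z}[X]$ with respect to the entries of $X$, set $R=S/(\det X)$, and let $\mathfrak{a}=(x_{12},\dots,x_{1n},x_{22},\dots,x_{2n})R$. Then \[ \left[\frac{\varphi_p(\det X)}{(x_{12}\cdots x_{1n}x_{22}\cdots x_{2n})^p}\right]\in H^{2n-2}_{\mathfrak{a}}(R) \] is a nonzero $p$-torsion element, and its image in $H^{2n-2}_{\mathfrak{a}}(R/pR)$ is nonzero. In particular, $H^{2n-2}_{\mathfrak{a}}(R)$ contains a nonzero $p$-torsion element for each prime $p>0$.
   Context: For a polynomial ring $S=\mathbb{Z}[\boldsymbol{x}]$, the standard lift of Frobenius $\Lambda_p$ is the ring endomorphism with $\Lambda_p(x)=x^p$ for each indeterminate $x$, and the standard $p$-derivation is $\varphi_p(s)=(\Lambda_p(s)-s^p)/p$. The local cohomology class is the Čech class (on the $2n-2$ listed generators of $\mathfrak{a}$) of the image of $\varphi_p(\det X)$ in $R$. *)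

theory Defs
  imports "HOL-Computational_Algebra.Primes" "HOL-Library.Poly_Mapping" "HOL-Combinatorics.Permutations"
begin

text \<open>The polynomial ring S = Z[x_ij : i,j < n] (0-indexed), as finitely supported
  maps from monomials (exponent vectors) to integer coefficients.\<close>
type_synonym mono = "(nat \<times> nat) \<Rightarrow>\<^sub>0 nat"
type_synonym zpoly = "mono \<Rightarrow>\<^sub>0 int"

definition var :: "nat \<Rightarrow> nat \<Rightarrow> zpoly" where
  "var i j = Poly_Mapping.single (Poly_Mapping.single (i, j) 1) 1"

definition const :: "int \<Rightarrow> zpoly" where
  "const c = Poly_Mapping.single 0 c"

definition detX :: "nat \<Rightarrow> zpoly" where
  "detX n = (\<Sum>\<sigma>\<in>{\<sigma>. \<sigma> permutes {0..<n}}.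
               const (sign \<sigma>) * (\<Prod>i\<in>{0..<n}. var i (\<sigma> i)))"

text \<open>Standard lift of Frobenius: the ring endomorphism with x \<mapsto> x^p.\<close>
definition Lambda :: "nat \<Rightarrow> zpoly \<Rightarrow> zpoly" where
  "Lambda p s = (\<Sum>m\<in>Poly_Mapping.keys s. Poly_Mapping.single (Poly_Mapping.map (\<lambda>e. p * e) m) (Poly_Mapping.lookup s m))"

text \<open>Standard p-derivation phi_p(s) = (Lambda_p(s) - s^p)/p
  (the division is exact; it is performed coefficientwise).\<close>
definition pder :: "nat \<Rightarrow> zpoly \<Rightarrow> zpoly" where
  "pder p s = Poly_Mapping.map (\<lambda>c. c div int p) (Lambda p s - s ^ p)"

definition zero_in_R :: "nat \<Rightarrow> zpoly \<Rightarrow> bool" where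
  "zero_in_R n a \<longleftrightarrow> (\<exists>b. a = b * detX n)"

definition zero_in_R_mod :: "nat \<Rightarrow> nat \<Rightarrow> zpoly \<Rightarrow> bool" where
  "zero_in_R_mod n p a \<longleftrightarrow> (\<exists>b c. a = b * detX n + c * const (int p))"

text \<open>Top Cech cohomology H^k_a(A) for generators f_g (g \<in> G, k = card G) of a ring A,
  which is the cokernel of the map (+)_g A_{f/f_g} \<rightarrow> A_f, f = prod f_g.
  Here A is a quotient of S whose zero test is Z.  The class [r / f^t] vanishes iff
  r/f^t equals, in A_f, the image of a tuple (s_g / (f/f_g)^m)_g, i.e. (sum s_g f_g^m)/f^m;
  by definition of localization this means f^N (r f^m - f^t sum s_g f_g^m) = 0 in A.\<close>
definition cech_top_class_zero ::
  "(zpoly \<Rightarrow> bool) \<Rightarrow> (nat \<times> nat) set \<Rightarrow> (nat \<times> nat \<Rightarrow> zpoly) \<Rightarrow> zpoly \<Rightarrow> nat \<Rightarrow> bool" where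
  "cech_top_class_zero Z G f r t \<longleftrightarrow>
     (\<exists>m N (s :: nat \<times> nat \<Rightarrow> zpoly).
        Z ((\<Prod>g\<in>G. f g) ^ N *
           (r * (\<Prod>g\<in>G. f g) ^ m - (\<Prod>g\<in>G. f g) ^ t * (\<Sum>g\<in>G. s g * f g ^ m))))"

text \<open>The generators x_12..x_1n, x_22..x_2n (1-indexed) = rows 0,1 and columns 1..n-1.\<close>
definition gens :: "nat \<Rightarrow> (nat \<times> nat) set" where
  "gens n = {(i, j). i < 2 \<and> 1 \<le> j \<and> j < n}"

definition gvar :: "nat \<times> nat \<Rightarrow> zpoly" where
  "gvar g = var (fst g) (snd g)"

end

theory Submission
  imports Defs "HOL.Modules"
begin

text \<open>
  Let \<open>d = det X\<close>, let \<open>f\<close> be the product of the generators \<open>g\<close>, and let \<open>\<phi>\<close> be the standard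
  \<open>p\<close>-derivation. Since \<open>p \<phi>(d) = \<Lambda>(d) - d ^ p\<close> and every term of \<open>\<Lambda>(d)\<close> is divisible by the \<open>p\<close>-th
  power of a generator, the class is killed by \<open>p\<close>.

  The class is nonzero modulo \<open>p\<close> if \<open>f ^ M \<phi>(d) \<notin> (p, d, g ^ (M + p) : g)\<close> for all \<open>M\<close>. This is detected by an
  additive map \<open>\<psi>\<close> from \<open>S\<close> to the integers. Let \<open>(u, a, b)\<close> and \<open>(v, c, e)\<close> be the first three entries of the first
  two rows, \<open>s\<close> and \<open>t\<close> the second and third entry of the third row, and \<open>y\<close> the product of the remaining diagonal
  entries. Modulo the variables that do not occur in the monomials read by \<open>\<psi>\<close>, \<open>d = y (t L - s K)\<close> with
  \<open>L = u c - a v\<close> and \<open>K = u e - b v\<close>. If \<open>F\<^sub>i\<close> is the coefficient of \<open>y ^ p t ^ i s ^ (p - i)\<close> in \<open>F\<close>, then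
  the sum of \<open>K ^ (i - 1) L ^ (p - i) F\<^sub>i\<close> over \<open>1 \<le> i \<le> p\<close> telescopes for \<open>F = d G\<close> to \<open>L ^ p G\<^sub>0\<close>, where \<open>G\<^sub>0\<close>
  is the coefficient of \<open>(y s) ^ (p - 1)\<close> in \<open>G\<close>. The map \<open>\<psi>\<close> takes the coefficient of
  \<open>f ^ M u ^ p v ^ (p - 1) c (a e) ^ (p - 1)\<close> in this sum. Modulo \<open>p\<close>, \<open>L ^ p = (u c) ^ p - (a v) ^ p\<close>; the second
  term has too many factors \<open>v\<close> to contribute, and the first one is cancelled by subtracting a single coefficient
  of \<open>(u c) ^ p F\<close>, so \<open>\<psi>(d G)\<close> is divisible by \<open>p\<close>. The value \<open>\<psi>(f ^ M d ^ p)\<close> is the coefficient of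
  \<open>(u e s y) ^ (p - 1) u c (a v) ^ (p - 1)\<close> in \<open>d ^ (p - 1) L ^ p\<close>, which is \<open>p\<close>, and therefore
  \<open>\<psi>(f ^ M \<phi>(d)) = - 1\<close>.
\<close>

abbreviation lookup :: "('a \<Rightarrow>\<^sub>0 'b::zero) \<Rightarrow> 'a \<Rightarrow> 'b" where
  "lookup \<equiv> Poly_Mapping.lookup"

abbreviation single :: "'a \<Rightarrow> 'b \<Rightarrow> 'a \<Rightarrow>\<^sub>0 'b::zero" where
  "single \<equiv> Poly_Mapping.single"

subsection \<open>Congruence below a monomial\<close>

definition cong_below ::
  "(('v \<Rightarrow>\<^sub>0 nat) \<Rightarrow>\<^sub>0 'a::zero) \<Rightarrow> (('v \<Rightarrow>\<^sub>0 nat) \<Rightarrow>\<^sub>0 'a) \<Rightarrow> ('v \<Rightarrow>\<^sub>0 nat) \<Rightarrow> bool"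
  ("(1[_ = _] '(below _'))") where
  "[F = G] (below \<mu>) \<longleftrightarrow> (\<forall>m. (\<forall>v. lookup m v \<le> lookup \<mu> v) \<longrightarrow> lookup F m = lookup G m)"

lemma lookup_eq_if_cong_below: "[F = G] (below \<mu>) \<Longrightarrow> lookup F \<mu> = lookup G \<mu>"
  by (simp add: cong_below_def)

lemma cong_below_refl [simp]: "[F = F] (below \<mu>)"
  by (simp add: cong_below_def)

lemma cong_below_trans [trans]:
  "[F = G] (below \<mu>) \<Longrightarrow> [G = H] (below \<mu>) \<Longrightarrow> [F = H] (below \<mu>)"
  by (simp add: cong_below_def)

lemma cong_below_add:
  "[F = F'] (below \<mu>) \<Longrightarrow> [G = G'] (below \<mu>) \<Longrightarrow> [F + G = F' + G'] (below \<mu>)"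
  by (simp add: cong_below_def lookup_add)

lemma cong_below_diff:
  fixes F G :: "('v \<Rightarrow>\<^sub>0 nat) \<Rightarrow>\<^sub>0 'a::ab_group_add"
  shows "[F = F'] (below \<mu>) \<Longrightarrow> [G = G'] (below \<mu>) \<Longrightarrow> [F - G = F' - G'] (below \<mu>)"
  by (simp add: cong_below_def lookup_minus)

lemma cong_below_sum:
  "(\<And>i. i \<in> I \<Longrightarrow> [F i = G i] (below \<mu>)) \<Longrightarrow> [(\<Sum>i\<in>I. F i) = (\<Sum>i\<in>I. G i)] (below \<mu>)"
  by (simp add: cong_below_def lookup_sum)

lemma cong_below_mult:
  fixes F G :: "('v \<Rightarrow>\<^sub>0 nat) \<Rightarrow>\<^sub>0 'a::semiring_0"
  assumes "[F = F'] (below \<mu>)" and "[G = G'] (below \<mu>)"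
  shows "[F * G = F' * G'] (below \<mu>)"
  unfolding cong_below_def
proof (intro allI impI)
  fix m assume m: "\<forall>v. lookup m v \<le> lookup \<mu> v"
  have "lookup F k = lookup F' k" and "lookup G l = lookup G' l" if "m = k + l" for k l
  proof -
    have "lookup k v \<le> lookup \<mu> v" and "lookup l v \<le> lookup \<mu> v" for v
      using m[rule_format, of v] that by (simp_all add: lookup_add)
    then show "lookup F k = lookup F' k" and "lookup G l = lookup G' l"
      using assms by (simp_all add: cong_below_def)
  qed
  then have "lookup F k * (\<Sum>l. lookup G l when m = k + l) =
      lookup F' k * (\<Sum>l. lookup G' l when m = k + l)" for k
    by (cases "\<exists>l. m = k + l") (auto simp: when_def cong: if_cong)
  then show "lookup (F * G) m = lookup (F' * G') m"
    by (simp add: lookup_mult)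
qed

lemma cong_below_power:
  fixes F :: "('v \<Rightarrow>\<^sub>0 nat) \<Rightarrow>\<^sub>0 'a::semiring_1"
  shows "[F = G] (below \<mu>) \<Longrightarrow> [F ^ k = G ^ k] (below \<mu>)"
  by (induction k) (simp_all add: cong_below_mult)

lemma cong_below_zero_if_single_dvd:
  fixes F :: "('v \<Rightarrow>\<^sub>0 nat) \<Rightarrow>\<^sub>0 'a::comm_semiring_1"
  assumes "single m c dvd F" and "lookup \<mu> v < lookup m v"
  shows "[F = 0] (below \<mu>)"
proof -
  have "[single m c = 0] (below \<mu>)"
    using assms(2) by (auto simp: cong_below_def lookup_single when_def dest: spec[of _ v])
  moreover obtain G where "F = single m c * G"
    using assms(1) by (rule dvdE)
  ultimately show ?thesis
    using cong_below_mult[of "single m c" 0 \<mu> G G] by simp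
qed

lemma lookup_mult_single_add:
  fixes F :: "'a::cancel_comm_monoid_add \<Rightarrow>\<^sub>0 'b::semiring_0"
  shows "lookup (F * single k c) (m + k) = lookup F m * c"
proof -
  have "(\<Sum>q. lookup (single k c) q when m + k = l + q) = (c when l = m)" for l
  proof -
    have "(\<Sum>q. lookup (single k c) q when m + k = l + q) = (\<Sum>q. (c when l = m) when q = k)"
      by (rule Sum_any.cong) (auto simp: lookup_single when_def)
    then show ?thesis by simp
  qed
  then show ?thesis
    by (simp add: lookup_mult mult_when)
qed

lemma power_single:
  fixes m :: "'a \<Rightarrow>\<^sub>0 nat" and c :: "'b::semiring_1"
  shows "single m c ^ k = single (Poly_Mapping.map ((*) k) m) (c ^ k)"
proof (induction k)
  case 0
  have "Poly_Mapping.map ((*) 0) m = 0"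
    by (simp add: Poly_Mapping.map_eq_zero_iff)
  then show ?case by (simp only: power_0 single_one)
next
  case (Suc k)
  have "m + Poly_Mapping.map ((*) k) m = Poly_Mapping.map ((*) (Suc k)) m"
    by (rule poly_mapping_eqI) (simp add: lookup_add Poly_Mapping.map.rep_eq when_def)
  then show ?case
    by (simp only: power_Suc Suc.IH mult_single)
qed

lemma prod_single:
  fixes m :: "'i \<Rightarrow> 'a::comm_monoid_add"
  shows "(\<Prod>i\<in>I. single (m i) (1::'b::comm_semiring_1)) = single (\<Sum>i\<in>I. m i) 1"
  by (induction I rule: infinite_finite_induct) (simp_all add: mult_single)

subsection \<open>The standard \<open>p\<close>-derivation\<close>

lemma prime_dvd_power_add:
  fixes x y :: "'a::comm_ring_1"
  assumes "prime p"
  shows "of_nat p dvd (x + y) ^ p - (x ^ p + y ^ p)"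
proof -
  have "0 < p" using assms by (rule prime_gt_0_nat)
  have "(x + y) ^ p = (\<Sum>k\<le>p. of_nat (p choose k) * x ^ k * y ^ (p - k))"
    by (rule binomial_ring)
  also have "{..p} = insert 0 (insert p {0<..<p})"
    using \<open>0 < p\<close> by auto
  also have "(\<Sum>k\<in>\<dots>. of_nat (p choose k) * x ^ k * y ^ (p - k)) =
      (x ^ p + y ^ p) + (\<Sum>k\<in>{0<..<p}. of_nat (p choose k) * x ^ k * y ^ (p - k))"
    using \<open>0 < p\<close> by simp
  finally have "(x + y) ^ p - (x ^ p + y ^ p) =
      (\<Sum>k\<in>{0<..<p}. of_nat (p choose k) * x ^ k * y ^ (p - k))"
    by simp
  moreover have "(of_nat p :: 'a) dvd of_nat (p choose k)" if "k \<in> {0<..<p}" for k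
    using that assms dvd_choose_prime[of k p] by (auto elim!: dvdE)
  ultimately show ?thesis
    by (auto intro!: dvd_sum dvd_mult2)
qed

lemma prime_dvd_power_diff:
  fixes x y :: "'a::comm_ring_1"
  assumes "prime p"
  shows "of_nat p dvd (x - y) ^ p - (x ^ p - y ^ p)"
  using prime_dvd_power_add[OF assms, of "x - y" y]
  by (subst dvd_minus_iff[symmetric]) (simp add: algebra_simps)

lemma Lambda_single: "Lambda p (single m c) = single (Poly_Mapping.map ((*) p) m) c"
  by (simp add: Lambda_def)

lemma additive_Lambda: "additive (Lambda p)"
  by standard (unfold Lambda_def, rule setsum_keys_plus_distrib, simp_all add: single_add)

lemma prime_dvd_Lambda_diff_power:
  assumes "prime p"
  shows "of_nat p dvd Lambda p F - F ^ p"
proof (rule frag_induction[of F UNIV "\<lambda>F. of_nat p dvd Lambda p F - F ^ p"])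
  show "of_nat p dvd Lambda p 0 - 0 ^ p"
    using prime_gt_0_nat[OF assms] by (simp add: Lambda_def power_0_left)
next
  fix m :: mono
  show "of_nat p dvd Lambda p (single m 1) - single m 1 ^ p"
    by (simp add: Lambda_single power_single)
next
  fix F G :: zpoly
  assume "of_nat p dvd Lambda p F - F ^ p" and "of_nat p dvd Lambda p G - G ^ p"
  moreover have "Lambda p (F - G) - (F - G) ^ p = (Lambda p F - F ^ p) - (Lambda p G - G ^ p)
      - ((F - G) ^ p - (F ^ p - G ^ p))"
    using additive.diff[OF additive_Lambda, of p F G] by simp
  ultimately show "of_nat p dvd Lambda p (F - G) - (F - G) ^ p"
    using prime_dvd_power_diff[OF assms, of F G] by (simp only: dvd_diff)
qed simp

lemma const_eq_of_int: "const c = of_int c"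
  using single_of_int[of c, where ?'b = int] by (simp add: const_def)

lemma const_mult_pder:
  assumes "prime p"
  shows "const (int p) * pder p F = Lambda p F - F ^ p"
proof -
  obtain Q where Q: "Lambda p F - F ^ p = const (int p) * Q"
    using prime_dvd_Lambda_diff_power[OF assms] by (auto elim: dvdE simp: const_eq_of_int)
  have "pder p F = Q"
    unfolding pder_def Q const_def mult_map_scale_conv_mult[symmetric]
    using prime_gt_0_nat[OF assms]
    by (intro poly_mapping_eqI) (auto simp: Poly_Mapping.map.rep_eq when_def)
  then show ?thesis by (simp add: Q)
qed

subsection \<open>Top Cech classes\<close>

lemma additive_mult_of_nat:
  fixes \<psi> :: "'a::ring_1 \<Rightarrow> 'b::ring_1"
  assumes "additive \<psi>"
  shows "\<psi> (of_nat k * x) = of_nat k * \<psi> x"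
  using additive.sum[OF assms, of "\<lambda>_. x" "{..<k}"] by simp

lemma prod_power_dvd:
  fixes f :: "'i \<Rightarrow> 'a::comm_semiring_1"
  assumes "finite G" and "g \<in> G"
  shows "f g ^ (k + l) dvd (\<Prod>h\<in>G. f h) ^ k * f g ^ l"
  unfolding power_add using assms by (intro mult_dvd_mono dvd_power_same dvd_prodI) auto

lemma cech_top_class_nonzeroI:
  fixes d :: int
  assumes "finite G"
    and additive: "\<And>M. additive (\<psi> M)"
    and zero: "\<And>M F. Z F \<Longrightarrow> d dvd \<psi> M F"
    and power: "\<And>M g F. g \<in> G \<Longrightarrow> f g ^ (M + t) dvd F \<Longrightarrow> \<psi> M F = 0"
    and nonzero: "\<And>M. \<not> d dvd \<psi> M ((\<Prod>g\<in>G. f g) ^ M * r)"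
  shows "\<not> cech_top_class_zero Z G f r t"
proof
  let ?f = "\<Prod>g\<in>G. f g"
  assume "cech_top_class_zero Z G f r t"
  then obtain m N s where Z: "Z (?f ^ N * (r * ?f ^ m - ?f ^ t * (\<Sum>g\<in>G. s g * f g ^ m)))"
    unfolding cech_top_class_zero_def by blast
  let ?h = "\<lambda>g. ?f ^ (N + t) * f g ^ m * s g"
  have "\<psi> (N + m) (?h g) = 0" if "g \<in> G" for g
    using prod_power_dvd[OF assms(1) that, of f "N + t" m]
    by (intro power[OF that]) (simp add: add_ac dvd_mult2)
  then have "\<psi> (N + m) (\<Sum>g\<in>G. ?h g) = 0"
    by (simp add: additive.sum[OF additive])
  moreover have "?f ^ N * (r * ?f ^ m - ?f ^ t * (\<Sum>g\<in>G. s g * f g ^ m)) =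
      ?f ^ (N + m) * r - (\<Sum>g\<in>G. ?h g)"
    by (simp add: right_diff_distrib power_add sum_distrib_left mult_ac)
  ultimately have "d dvd \<psi> (N + m) (?f ^ (N + m) * r)"
    using zero[OF Z, of "N + m"] by (simp add: additive.diff[OF additive])
  then show False using nonzero by blast
qed

lemma cech_top_class_zeroI:
  assumes "Z ((\<Prod>g\<in>G. f g) ^ t * (r - (\<Sum>g\<in>G. s g * f g ^ t)))"
  shows "cech_top_class_zero Z G f r t"
proof -
  have "Z ((\<Prod>g\<in>G. f g) ^ 0 * (r * (\<Prod>g\<in>G. f g) ^ t - (\<Prod>g\<in>G. f g) ^ t * (\<Sum>g\<in>G. s g * f g ^ t)))"
    using assms by (simp add: right_diff_distrib mult.commute)
  then show ?thesis unfolding cech_top_class_zero_def by blast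
qed

lemma cech_top_class_zero_mono:
  assumes "cech_top_class_zero Z G f r t" and "\<And>F. Z F \<Longrightarrow> Z' F"
  shows "cech_top_class_zero Z' G f r t"
  using assms unfolding cech_top_class_zero_def by blast

subsection \<open>Torsion\<close>

lemma sum_in_ideal_if_dvd:
  fixes F :: "'i \<Rightarrow> 'a::comm_semiring_1"
  assumes "finite I" and "finite G" and "\<And>i. i \<in> I \<Longrightarrow> \<exists>g\<in>G. h g dvd F i"
  obtains s where "(\<Sum>i\<in>I. F i) = (\<Sum>g\<in>G. s g * h g)"
proof -
  obtain \<gamma> where \<gamma>: "\<gamma> i \<in> G" "h (\<gamma> i) dvd F i" if "i \<in> I" for i
    using assms(3) by metis
  have "h g dvd (\<Sum>i | i \<in> I \<and> \<gamma> i = g. F i)" for g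
    using \<gamma>(2) by (auto intro: dvd_sum)
  then obtain s where s: "(\<Sum>i | i \<in> I \<and> \<gamma> i = g. F i) = s g * h g" for g
    unfolding dvd_def by (metis mult.commute)
  have "(\<Sum>i\<in>I. F i) = (\<Sum>g\<in>G. \<Sum>i | i \<in> I \<and> \<gamma> i = g. F i)"
    using \<gamma>(1) by (intro sum.group[OF assms(1,2), symmetric]) auto
  then show thesis using that s by simp
qed

lemma var_power: "var i j ^ k = single (single (i, j) k) 1"
  by (simp add: var_def power_single)

lemma gvar_power: "gvar g ^ k = single (single g k) 1"
  by (simp add: gvar_def var_power)

lemma cong_below_zero_if_gvar_power_dvd:
  "gvar g ^ k dvd F \<Longrightarrow> lookup \<mu> g < k \<Longrightarrow> [F = 0] (below \<mu>)"
  by (rule cong_below_zero_if_single_dvd[of "single g k" 1 _ _ g]) (simp_all add: gvar_power)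

lemma cong_below_zero_if_var_dvd:
  "var i j dvd F \<Longrightarrow> lookup \<mu> (i, j) = 0 \<Longrightarrow> [F = 0] (below \<mu>)"
  using cong_below_zero_if_gvar_power_dvd[of "(i, j)" 1] by (simp add: gvar_def)

lemma Lambda_detX:
  "Lambda p (detX n) =
     (\<Sum>\<sigma> | \<sigma> permutes {0..<n}. const (sign \<sigma>) * (\<Prod>i\<in>{0..<n}. var i (\<sigma> i)) ^ p)"
proof -
  have "Lambda p (const c * (\<Prod>i\<in>I. var i (\<sigma> i))) = const c * (\<Prod>i\<in>I. var i (\<sigma> i)) ^ p" for c \<sigma> I
    by (simp add: var_def const_def prod_single mult_single power_single Lambda_single)
  then show ?thesis
    by (simp add: detX_def additive.sum[OF additive_Lambda])
qed

lemma finite_gens [simp]: "finite (gens n)"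
  by (rule finite_subset[of _ "{..<2} \<times> {..<n}"]) (auto simp: gens_def)

lemma gvar_dvd_permutation_monomial:
  assumes "2 \<le> n" and "\<sigma> permutes {0..<n}"
  shows "\<exists>g\<in>gens n. gvar g dvd (\<Prod>i\<in>{0..<n}. var i (\<sigma> i))"
proof -
  have "\<sigma> 0 \<noteq> \<sigma> 1"
    using permutes_inj[OF assms(2)] by (auto simp: inj_def)
  then obtain i where i: "i < 2" "\<sigma> i \<noteq> 0"
    by (metis One_nat_def less_2_cases_iff)
  then have "i < n" using assms(1) by simp
  then have "(i, \<sigma> i) \<in> gens n"
    using i permutes_in_image[OF assms(2), of i] by (simp add: gens_def)
  moreover have "gvar (i, \<sigma> i) dvd (\<Prod>i\<in>{0..<n}. var i (\<sigma> i))"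
    using \<open>i < n\<close> by (auto simp: gvar_def intro: dvd_prodI[of _ i "\<lambda>i. var i (\<sigma> i)"])
  ultimately show ?thesis by blast
qed

lemma Lambda_detX_in_gvar_powers:
  assumes "2 \<le> n"
  obtains s where "Lambda p (detX n) = (\<Sum>g\<in>gens n. s g * gvar g ^ p)"
proof (rule sum_in_ideal_if_dvd[of "{\<sigma>. \<sigma> permutes {0..<n}}" "gens n" "\<lambda>g. gvar g ^ p"
      "\<lambda>\<sigma>. const (sign \<sigma>) * (\<Prod>i\<in>{0..<n}. var i (\<sigma> i)) ^ p"])
  fix \<sigma> assume "\<sigma> \<in> {\<sigma>. \<sigma> permutes {0..<n}}"
  then obtain g where "g \<in> gens n" "gvar g dvd (\<Prod>i\<in>{0..<n}. var i (\<sigma> i))"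
    using gvar_dvd_permutation_monomial[OF assms] by blast
  then show "\<exists>g\<in>gens n. gvar g ^ p dvd const (sign \<sigma>) * (\<Prod>i\<in>{0..<n}. var i (\<sigma> i)) ^ p"
    by (blast intro: dvd_mult dvd_power_same)
qed (use that in \<open>auto simp: finite_permutations Lambda_detX\<close>)

lemma prime_mult_pder_detX_class_zero:
  assumes "2 \<le> n" and "prime p"
  shows "cech_top_class_zero (zero_in_R n) (gens n) gvar (const (int p) * pder p (detX n)) p"
proof -
  obtain s where "Lambda p (detX n) = (\<Sum>g\<in>gens n. s g * gvar g ^ p)"
    using Lambda_detX_in_gvar_powers[OF assms(1)] .
  moreover have "detX n ^ p = detX n ^ (p - 1) * detX n"
    using power_minus_mult[OF prime_gt_0_nat[OF assms(2)], of "detX n"] by simp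
  ultimately have "const (int p) * pder p (detX n) - (\<Sum>g\<in>gens n. s g * gvar g ^ p) =
      - (detX n ^ (p - 1)) * detX n"
    unfolding const_mult_pder[OF assms(2)] by simp
  then show ?thesis
    by (intro cech_top_class_zeroI[of _ _ _ _ _ s])
       (metis zero_in_R_def mult.assoc)
qed

subsection \<open>The determinant modulo absent variables\<close>

lemma leibniz_formula_3:
  fixes a :: "nat \<Rightarrow> nat \<Rightarrow> 'a::comm_ring_1"
  shows "(\<Sum>\<sigma> | \<sigma> permutes {0..<3}. of_int (sign \<sigma>) * (\<Prod>i\<in>{0..<3}. a i (\<sigma> i))) =
    a 2 0 * (a 0 1 * a 1 2 - a 0 2 * a 1 1) - a 2 1 * (a 0 0 * a 1 2 - a 0 2 * a 1 0)
      + a 2 2 * (a 0 0 * a 1 1 - a 0 1 * a 1 0)"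
proof -
  have "{0..<3} = insert 0 (insert 1 {2::nat})" by auto
  then show ?thesis
    by (simp only:) ((subst sum_over_permutations_insert, simp, simp)+,
      simp add: sign_swap_id permutation_swap_id permutation_compose sign_compose transpose_def algebra_simps)
qed

definition diag_prod :: "nat \<Rightarrow> nat \<Rightarrow> zpoly" where
  "diag_prod k n = (\<Prod>i=k..<n. var i i)"

lemma prod_var_permutes_atLeastLessThan:
  assumes "\<sigma> permutes {0..<k}" and "k \<le> n"
  shows "(\<Prod>i\<in>{0..<n}. var i (\<sigma> i)) = (\<Prod>i\<in>{0..<k}. var i (\<sigma> i)) * diag_prod k n"
proof -
  have "(\<Prod>i=k..<n. var i (\<sigma> i)) = diag_prod k n"
    unfolding diag_prod_def using permutes_not_in[OF assms(1)] by (intro prod.cong) auto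
  then show ?thesis
    using prod.atLeastLessThan_concat[of 0 k n "\<lambda>i. var i (\<sigma> i)"] assms(2) by simp
qed

lemma detX_cong_below_block:
  assumes "k \<le> n" and absent: "\<And>i j. k \<le> i \<Longrightarrow> i \<noteq> j \<Longrightarrow> lookup \<mu> (i, j) = 0"
  shows "[detX n = detX k * diag_prod k n] (below \<mu>)"
proof -
  let ?T = "\<lambda>\<sigma>. const (sign \<sigma>) * (\<Prod>i\<in>{0..<n}. var i (\<sigma> i))"
  have "[?T \<sigma> = (if \<sigma> permutes {0..<k} then ?T \<sigma> else 0)] (below \<mu>)"
    if perm: "\<sigma> permutes {0..<n}" for \<sigma>
  proof (cases "\<sigma> permutes {0..<k}")
    case False
    then obtain i where "i < n" "k \<le> i" "\<sigma> i \<noteq> i"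
      using permutes_superset[OF perm, of "{0..<k}"] by (metis Diff_iff atLeastLessThan_iff not_le)
    moreover have "var i (\<sigma> i) dvd ?T \<sigma>"
      using \<open>i < n\<close> by (intro dvd_mult dvd_prodI[of _ i "\<lambda>i. var i (\<sigma> i)"]) auto
    ultimately show ?thesis
      using False absent[of i "\<sigma> i"] cong_below_zero_if_var_dvd by auto
  qed simp
  then have "[detX n = (\<Sum>\<sigma> | \<sigma> permutes {0..<n}. if \<sigma> permutes {0..<k} then ?T \<sigma> else 0)] (below \<mu>)"
    unfolding detX_def by (intro cong_below_sum) simp
  also have "(\<Sum>\<sigma> | \<sigma> permutes {0..<n}. if \<sigma> permutes {0..<k} then ?T \<sigma> else 0) =
      (\<Sum>\<sigma> | \<sigma> permutes {0..<k}. ?T \<sigma>)"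
    using permutes_subset[of _ "{0..<k}" "{0..<n}"] assms(1)
    by (subst sum.inter_filter[symmetric]) (auto simp: finite_permutations intro!: sum.cong)
  also have "\<dots> = detX k * diag_prod k n"
    by (simp add: detX_def sum_distrib_right mult.assoc prod_var_permutes_atLeastLessThan[OF _ assms(1)])
  finally show ?thesis .
qed

definition top_minor :: "nat \<Rightarrow> zpoly" where
  "top_minor j = var 0 0 * var 1 j - var 0 j * var 1 0"

lemma detX_3:
  "detX 3 = var 2 0 * (var 0 1 * var 1 2 - var 0 2 * var 1 1)
     + (var 2 2 * top_minor 1 - var 2 1 * top_minor 2)"
  using leibniz_formula_3[of var] by (simp add: detX_def const_eq_of_int top_minor_def)

lemma detX_cong_below_top_minors:
  assumes "3 \<le> n" and "lookup \<mu> (2, 0) = 0"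
    and "\<And>i j. 3 \<le> i \<Longrightarrow> i \<noteq> j \<Longrightarrow> lookup \<mu> (i, j) = 0"
  shows "[detX n = (var 2 2 * top_minor 1 - var 2 1 * top_minor 2) * diag_prod 3 n] (below \<mu>)"
proof -
  have "[detX n = detX 3 * diag_prod 3 n] (below \<mu>)"
    using assms(1,3) by (rule detX_cong_below_block)
  also have "[detX 3 * diag_prod 3 n = (0 + (var 2 2 * top_minor 1 - var 2 1 * top_minor 2)) * diag_prod 3 n]
      (below \<mu>)"
    unfolding detX_3 using assms(2)
    by (intro cong_below_mult cong_below_add cong_below_refl cong_below_zero_if_var_dvd[of 2 0]) simp_all
  finally show ?thesis by simp
qed

subsection \<open>The test functional\<close>

abbreviation gens_prod :: "nat \<Rightarrow> zpoly" where
  "gens_prod n \<equiv> (\<Prod>g\<in>gens n. gvar g)"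

definition gens_exp :: "nat \<Rightarrow> nat \<Rightarrow> mono" where
  "gens_exp n M = (\<Sum>g\<in>gens n. single g M)"

lemma lookup_gens_exp: "lookup (gens_exp n M) g = (if g \<in> gens n then M else 0)"
  by (simp add: gens_exp_def lookup_sum lookup_single when_def)

lemma gens_prod_power: "gens_prod n ^ M = single (gens_exp n M) 1"
  by (simp add: prod_power_distrib gvar_power prod_single gens_exp_def)

definition diag_exp :: "nat \<Rightarrow> nat \<Rightarrow> mono" where
  "diag_exp n k = (\<Sum>i=3..<n. single (i, i) k)"

lemma lookup_diag_exp: "lookup (diag_exp n k) (i, j) = (if i = j \<and> 3 \<le> i \<and> i < n then k else 0)"
proof -
  have "lookup (diag_exp n k) (i, j) = (\<Sum>l=3..<n. if l = i then (if i = j then k else 0) else 0)"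
    unfolding diag_exp_def lookup_sum by (intro sum.cong) (auto simp: lookup_single when_def)
  then show ?thesis by simp
qed

lemma diag_prod_power: "diag_prod 3 n ^ k = single (diag_exp n k) 1"
  by (simp add: diag_prod_def prod_power_distrib var_power prod_single diag_exp_def)

definition target_exp :: "nat \<Rightarrow> nat \<Rightarrow> nat \<Rightarrow> nat \<Rightarrow> mono" where
  "target_exp n p M i = gens_exp n M
     + (single (0, 0) p + single (1, 0) (p - 1) + single (1, 1) 1 + single (0, 1) (p - 1) + single (1, 2) (p - 1))
     + single (2, 1) (p - 1 - i) + single (2, 2) i + diag_exp n (p - 1)"

lemma lookup_target_exp:
  "lookup (target_exp n p M i) (0, 0) = p"
  "lookup (target_exp n p M i) (1, 0) = p - 1"
  "lookup (target_exp n p M i) (2, 0) = 0"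
  "lookup (target_exp n p M i) (2, 1) = p - 1 - i"
  "lookup (target_exp n p M i) (2, 2) = i"
  "3 \<le> n \<Longrightarrow> lookup (target_exp n p M i) (1, 1) = M + 1"
  "3 \<le> n \<Longrightarrow> lookup (target_exp n p M i) (0, 2) = M"
  "3 \<le> k \<Longrightarrow> k \<noteq> l \<Longrightarrow> lookup (target_exp n p M i) (k, l) = 0"
  by (auto simp: target_exp_def lookup_add lookup_gens_exp lookup_diag_exp lookup_single gens_def)

lemma lookup_target_exp_gens_less:
  assumes "2 \<le> p" and "g \<in> gens n"
  shows "lookup (target_exp n p M i) g < M + p"
proof -
  obtain k l where g: "g = (k, l)" "k = 0 \<or> k = 1" "1 \<le> l"
    using assms(2) by (auto simp: gens_def less_2_cases_iff)
  from g(2) show ?thesis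
    using g(1,3) assms(1)
    by (elim disjE) (auto simp: target_exp_def lookup_add lookup_gens_exp lookup_diag_exp lookup_single when_def)
qed

lemma target_exp_Suc:
  assumes "Suc i < p"
  shows "target_exp n p M (Suc i) + single (2, 1) 1 = target_exp n p M i + single (2, 2) 1"
proof -
  have "p - 1 - i = (p - 1 - Suc i) + 1" using assms by simp
  then show ?thesis
    unfolding target_exp_def by (simp only: single_add Suc_eq_plus1 add_ac)
qed

definition correction_exp :: "nat \<Rightarrow> mono" where
  "correction_exp n = single (0, 2) 1 + single (1, 0) 1 + single (2, 1) 1 + diag_exp n 1"

lemma lookup_correction_exp:
  "lookup (correction_exp n) (0, 0) = 0"
  "lookup (correction_exp n) (2, 0) = 0"
  "lookup (correction_exp n) (2, 2) = 0"
  "3 \<le> k \<Longrightarrow> k \<noteq> l \<Longrightarrow> lookup (correction_exp n) (k, l) = 0"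
  "g \<in> gens n \<Longrightarrow> lookup (correction_exp n) g = (if g = (0, 2) then 1 else 0)"
  by (auto simp: correction_exp_def lookup_add lookup_diag_exp lookup_single gens_def when_def)

text \<open>Summand \<open>i\<close> is the contribution of the coefficient \<open>F\<^sub>j\<close> of the introduction with \<open>j = i + 1\<close>.\<close>

definition test_functional :: "nat \<Rightarrow> nat \<Rightarrow> nat \<Rightarrow> zpoly \<Rightarrow> int" where
  "test_functional n p M F =
     (\<Sum>i<p. lookup (F * (top_minor 1 ^ (p - 1 - i) * top_minor 2 ^ i))
        (target_exp n p M i + (single (2, 2) 1 + diag_exp n 1)))
     - lookup (F * (var 0 0 * var 1 1) ^ p) (target_exp n p M 0 + correction_exp n)"

lemma additive_test_functional: "additive (test_functional n p M)"
  by standard (simp add: test_functional_def distrib_right lookup_add sum.distrib)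

lemma test_functional_zero_if_gvar_power_dvd:
  assumes "2 \<le> p" and "g \<in> gens n" and "gvar g ^ (M + p) dvd F"
  shows "test_functional n p M F = 0"
proof -
  have lookup_zero: "lookup (F * H) (target_exp n p M i + \<nu>) = 0"
    if "lookup (target_exp n p M i) g + lookup \<nu> g < M + p" for H i \<nu>
  proof -
    have "[F * H = 0] (below target_exp n p M i + \<nu>)"
      using that assms(3) by (intro cong_below_zero_if_gvar_power_dvd[of g "M + p"]) (simp_all add: lookup_add)
    then show ?thesis by (simp add: lookup_eq_if_cong_below)
  qed
  have target_less: "lookup (target_exp n p M i) g < M + p" for i
    using assms(1,2) by (rule lookup_target_exp_gens_less)
  have "lookup (target_exp n p M 0) g + lookup (correction_exp n) g < M + p"
  proof (cases "g = (0, 2)")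
    case True
    then have "3 \<le> n" using assms(2) by (auto simp: gens_def)
    then show ?thesis
      using True assms(1,2) by (simp add: lookup_target_exp lookup_correction_exp)
  qed (use target_less assms(2) in \<open>simp add: lookup_correction_exp\<close>)
  moreover have "lookup (single (2, 2) 1 + diag_exp n 1) g = 0"
    using assms(2) by (auto simp: lookup_add lookup_diag_exp lookup_single gens_def when_def)
  ultimately show ?thesis
    unfolding test_functional_def by (simp add: lookup_zero target_less)
qed

lemma lookup_mult_single_target_exp:
  fixes H :: zpoly
  assumes "i < p"
  shows "lookup (H * single (single (2, 1) 1 + diag_exp n 1) 1) (target_exp n p M i + (single (2, 2) 1 + diag_exp n 1)) =
    (if Suc i < p then lookup H (target_exp n p M (Suc i)) else 0)"
    (is "lookup (_ * single ?k 1) ?\<mu> = _")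
proof (cases "Suc i < p")
  case True
  have "?\<mu> = target_exp n p M (Suc i) + ?k"
    using arg_cong[OF target_exp_Suc[OF True], of "(+) (diag_exp n 1)"] by (simp only: add_ac)
  then show ?thesis
    using True by (simp only: lookup_mult_single_add mult_1_right if_True)
next
  case False
  then have "lookup ?\<mu> (2, 1) < lookup ?k (2, 1)"
    using assms by (simp add: lookup_add lookup_target_exp lookup_diag_exp lookup_single del: One_nat_def)
  then have "[H * single ?k 1 = 0] (below ?\<mu>)"
    by (intro cong_below_zero_if_single_dvd[of ?k 1]) simp_all
  then show ?thesis
    using False by (simp add: lookup_eq_if_cong_below)
qed

lemma lookup_mult_detX_top_minors:
  assumes "3 \<le> n" and "i < p"
  shows "lookup (F * detX n * (top_minor 1 ^ (p - 1 - i) * top_minor 2 ^ i))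
        (target_exp n p M i + (single (2, 2) 1 + diag_exp n 1)) =
      lookup (F * (top_minor 1 ^ (p - i) * top_minor 2 ^ i)) (target_exp n p M i)
      - (if Suc i < p
         then lookup (F * (top_minor 1 ^ (p - Suc i) * top_minor 2 ^ Suc i)) (target_exp n p M (Suc i))
         else 0)"
    (is "lookup (F * _ * ?P) ?\<mu> = lookup ?H _ - (if _ then lookup ?H' _ else 0)")
proof -
  let ?m = "\<lambda>k. single (single (2, k) 1 + diag_exp n 1) 1"
  have var_mult_diag_prod: "var 2 k * diag_prod 3 n = ?m k" for k
    using diag_prod_power[of n 1] var_power[of 2 k 1] by (simp add: mult_single)
  have exponents: "p - i = Suc (p - 1 - i)" "p - Suc i = p - 1 - i" using assms(2) by auto
  have "[detX n = (var 2 2 * top_minor 1 - var 2 1 * top_minor 2) * diag_prod 3 n] (below ?\<mu>)"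
    using assms(1) by (intro detX_cong_below_top_minors)
      (auto simp: lookup_add lookup_target_exp lookup_diag_exp lookup_single)
  then have "[F * detX n * ?P = F * ((var 2 2 * top_minor 1 - var 2 1 * top_minor 2) * diag_prod 3 n) * ?P]
      (below ?\<mu>)"
    by (intro cong_below_mult) simp_all
  also have "F * ((var 2 2 * top_minor 1 - var 2 1 * top_minor 2) * diag_prod 3 n) * ?P = ?H * ?m 2 - ?H' * ?m 1"
    unfolding exponents var_mult_diag_prod[symmetric] by (simp add: algebra_simps)
  finally have "lookup (F * detX n * ?P) ?\<mu> = lookup (?H * ?m 2) ?\<mu> - lookup (?H' * ?m 1) ?\<mu>"
    by (simp add: lookup_eq_if_cong_below lookup_minus)
  then show ?thesis
    by (simp only: lookup_mult_single_target_exp[OF assms(2)] lookup_mult_single_add mult_1_right)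
qed

lemma lookup_mult_detX_correction:
  assumes "3 \<le> n"
  shows "lookup (F * detX n * (var 0 0 * var 1 1) ^ p) (target_exp n p M 0 + correction_exp n) =
      lookup (F * (var 0 0 * var 1 1) ^ p) (target_exp n p M 0)"
    (is "lookup (_ * ?U ^ p) ?\<mu> = _")
proof -
  let ?D = "diag_prod 3 n"
  let ?Q = "var 2 2 * (?D * top_minor 1 * F * ?U ^ p)"
  let ?R = "var 0 0 ^ Suc p * (?D * var 2 1 * var 1 2 * F * var 1 1 ^ p)"
  have correction_monomial: "var 0 2 * var 1 0 * var 2 1 * ?D = single (correction_exp n) 1"
    using diag_prod_power[of n 1] var_power[of _ _ 1] by (simp add: correction_exp_def mult_single)
  have "[detX n = (var 2 2 * top_minor 1 - var 2 1 * top_minor 2) * ?D] (below ?\<mu>)"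
    using assms by (intro detX_cong_below_top_minors)
      (simp_all add: lookup_add lookup_target_exp lookup_correction_exp)
  then have "[F * detX n * ?U ^ p = F * ((var 2 2 * top_minor 1 - var 2 1 * top_minor 2) * ?D) * ?U ^ p]
      (below ?\<mu>)"
    by (intro cong_below_mult) simp_all
  also have "F * ((var 2 2 * top_minor 1 - var 2 1 * top_minor 2) * ?D) * ?U ^ p =
      F * ?U ^ p * single (correction_exp n) 1 + ?Q - ?R"
    unfolding correction_monomial[symmetric] by (simp add: top_minor_def algebra_simps)
  also have "[\<dots> = F * ?U ^ p * single (correction_exp n) 1 + 0 - 0] (below ?\<mu>)"
  proof (intro cong_below_add cong_below_diff cong_below_refl)
    show "[?Q = 0] (below ?\<mu>)"
      by (rule cong_below_zero_if_var_dvd[of 2 2])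
        (simp_all add: lookup_add lookup_target_exp lookup_correction_exp)
    show "[?R = 0] (below ?\<mu>)"
      by (rule cong_below_zero_if_gvar_power_dvd[of "(0, 0)" "Suc p"])
        (simp_all add: gvar_def lookup_add lookup_target_exp lookup_correction_exp del: power_Suc)
  qed
  finally show ?thesis
    by (simp add: lookup_eq_if_cong_below lookup_mult_single_add)
qed

lemma test_functional_mult_detX:
  assumes "3 \<le> n" and "0 < p"
  shows "test_functional n p M (F * detX n) =
    lookup (F * top_minor 1 ^ p) (target_exp n p M 0) - lookup (F * (var 0 0 * var 1 1) ^ p) (target_exp n p M 0)"
proof -
  define T where "T i =
    (if i < p then lookup (F * (top_minor 1 ^ (p - i) * top_minor 2 ^ i)) (target_exp n p M i) else 0)" for i
  have "(\<Sum>i<p. lookup (F * detX n * (top_minor 1 ^ (p - 1 - i) * top_minor 2 ^ i))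
        (target_exp n p M i + (single (2, 2) 1 + diag_exp n 1))) = (\<Sum>i<p. T i - T (Suc i))"
    using lookup_mult_detX_top_minors[OF assms(1)] by (intro sum.cong) (simp_all add: T_def)
  also have "\<dots> = T 0 - T p"
    by (rule sum_lessThan_telescope')
  finally show ?thesis
    unfolding test_functional_def lookup_mult_detX_correction[OF assms(1)]
    using assms(2) by (simp add: T_def)
qed

lemma prime_dvd_test_functional_mult_detX:
  assumes "3 \<le> n" and "prime p"
  shows "int p dvd test_functional n p M (F * detX n)"
proof -
  let ?\<mu> = "target_exp n p M 0" and ?U = "var 0 0 * var 1 1" and ?V = "var 0 1 * var 1 0"
  have "0 < p" using assms(2) by (rule prime_gt_0_nat)
  have "[F * ?V ^ p = 0] (below ?\<mu>)"
    using \<open>0 < p\<close> by (intro cong_below_zero_if_gvar_power_dvd[of "(1, 0)" p])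
       (simp_all add: gvar_def power_mult_distrib lookup_target_exp del: One_nat_def)
  then have lookup_V_power: "lookup (F * ?V ^ p) ?\<mu> = 0"
    by (simp add: lookup_eq_if_cong_below)
  obtain H where "top_minor 1 ^ p - (?U ^ p - ?V ^ p) = of_nat p * H"
    using prime_dvd_power_diff[OF assms(2), of ?U ?V] by (auto simp: top_minor_def elim: dvdE)
  then have top_minor_power: "top_minor 1 ^ p = ?U ^ p - ?V ^ p + of_nat p * H"
    by (simp only: diff_eq_eq add.commute)
  have "F * top_minor 1 ^ p - F * ?U ^ p = of_nat p * (F * H) - F * ?V ^ p"
    unfolding top_minor_power by (simp add: algebra_simps)
  then have "lookup (F * top_minor 1 ^ p) ?\<mu> - lookup (F * ?U ^ p) ?\<mu> =
      lookup (of_nat p * (F * H)) ?\<mu> - lookup (F * ?V ^ p) ?\<mu>"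
    by (simp only: flip: lookup_minus)
  also have "lookup (of_nat p * (F * H)) ?\<mu> = int p * lookup (F * H) ?\<mu>"
    using lookup_mult_single_add[of "F * H" 0 "int p" ?\<mu>] by (simp add: mult.commute)
  finally show ?thesis
    by (simp only: test_functional_mult_detX[OF assms(1) \<open>0 < p\<close>] lookup_V_power diff_zero dvd_triv_left)
qed

lemma detX_cong_below_target_exp:
  assumes "3 \<le> n"
  shows "[detX n = - (var 0 0 * var 1 2 * var 2 1 * diag_prod 3 n)] (below target_exp n p 0 0)"
    (is "[_ = - ?E] (below ?\<rho>)")
proof -
  let ?D = "diag_prod 3 n"
  have "[detX n = (var 2 2 * top_minor 1 - var 2 1 * top_minor 2) * ?D] (below ?\<rho>)"
    using assms by (intro detX_cong_below_top_minors) (simp_all add: lookup_target_exp)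
  also have "(var 2 2 * top_minor 1 - var 2 1 * top_minor 2) * ?D =
      var 2 2 * (top_minor 1 * ?D) + var 0 2 * (var 1 0 * var 2 1 * ?D) - ?E"
    by (simp add: top_minor_def algebra_simps)
  also have "[\<dots> = 0 + 0 - ?E] (below ?\<rho>)"
  proof (intro cong_below_add cong_below_diff cong_below_refl)
    show "[var 2 2 * (top_minor 1 * ?D) = 0] (below ?\<rho>)"
      by (rule cong_below_zero_if_var_dvd[of 2 2]) (simp_all add: lookup_target_exp)
    show "[var 0 2 * (var 1 0 * var 2 1 * ?D) = 0] (below ?\<rho>)"
      using assms by (intro cong_below_zero_if_var_dvd[of 0 2]) (simp_all add: lookup_target_exp)
  qed
  finally show ?thesis by simp
qed

lemma top_minor_power_cong_below_target_exp:
  assumes "3 \<le> n" and "0 < p"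
  shows "[top_minor 1 ^ p = (- (var 0 1 * var 1 0)) ^ (p - 1) * (var 0 0 * var 1 1) * of_nat p]
    (below target_exp n p 0 0)"
    (is "[_ = (- ?V) ^ _ * ?U * _] (below ?\<rho>)")
proof -
  let ?T = "\<lambda>k. of_nat (p choose k) * ?U ^ k * (- ?V) ^ (p - k)"
  have linear_term: "(\<Sum>k\<le>p. if k = 1 then ?T k else 0) = (- ?V) ^ (p - 1) * ?U * of_nat p"
    using assms(2) by (simp add: mult_ac)
  have binomial_expansion: "top_minor 1 ^ p = (\<Sum>k\<le>p. ?T k)"
    using binomial_ring[of ?U "- ?V" p] by (simp add: top_minor_def)
  show ?thesis
    unfolding binomial_expansion linear_term[symmetric]
  proof (rule cong_below_sum)
    fix k :: nat
    consider "k = 0" | "k = 1" | "2 \<le> k" by linarith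
    then show "[?T k = (if k = 1 then ?T k else 0)] (below ?\<rho>)"
    proof cases
      case 1
      have "gvar (1, 0) ^ p dvd ?T k"
        by (simp add: 1 gvar_def power_minus[of "_ * _"] power_mult_distrib)
      then show ?thesis
        using 1 assms(2) by (simp add: cong_below_zero_if_gvar_power_dvd lookup_target_exp del: One_nat_def)
    next
      case 3
      then have "gvar (1, 1) ^ 2 dvd ?T k"
        by (simp add: gvar_def power_mult_distrib le_imp_power_dvd)
      then show ?thesis
        using 3 assms(1) by (simp add: cong_below_zero_if_gvar_power_dvd lookup_target_exp del: One_nat_def)
    qed simp
  qed
qed

lemma lookup_detX_power_mult_top_minor_power:
  assumes "3 \<le> n" and "0 < p"
  shows "lookup (detX n ^ (p - 1) * top_minor 1 ^ p) (target_exp n p 0 0) = int p"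
proof -
  let ?E = "var 0 0 * var 1 2 * var 2 1 * diag_prod 3 n"
  let ?U = "var 0 0 * var 1 1" and ?V = "var 0 1 * var 1 0"
  have "(?E * ?V) ^ (p - 1) * ?U = var 0 0 ^ p * var 1 0 ^ (p - 1) * var 1 1 ^ 1 * var 0 1 ^ (p - 1)
      * var 1 2 ^ (p - 1) * var 2 1 ^ (p - 1) * diag_prod 3 n ^ (p - 1)"
    unfolding power_minus_mult[OF assms(2), of "var 0 0", symmetric] by (simp add: power_mult_distrib mult_ac)
  also have "\<dots> = single (target_exp n p 0 0) 1"
    unfolding var_power diag_prod_power mult_single by (simp add: target_exp_def gens_exp_def)
  finally have target_monomial: "(?E * ?V) ^ (p - 1) * ?U = single (target_exp n p 0 0) 1" .
  have "[detX n ^ (p - 1) * top_minor 1 ^ p = (- ?E) ^ (p - 1) * ((- ?V) ^ (p - 1) * ?U * of_nat p)]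
      (below target_exp n p 0 0)"
    using assms by (intro cong_below_mult cong_below_power detX_cong_below_target_exp
        top_minor_power_cong_below_target_exp)
  also have "(- ?E) ^ (p - 1) * ((- ?V) ^ (p - 1) * ?U * of_nat p) = (?E * ?V) ^ (p - 1) * ?U * of_nat p"
    by (simp flip: power_mult_distrib mult.assoc)
  also have "\<dots> = single (target_exp n p 0 0) 1 * of_nat p"
    by (simp only: target_monomial)
  finally show ?thesis
    using lookup_mult_single_add[of "single (target_exp n p 0 0) 1" 0 "int p" "target_exp n p 0 0"]
    by (simp add: lookup_eq_if_cong_below)
qed

lemma test_functional_detX_power:
  assumes "3 \<le> n" and "2 \<le> p"
  shows "test_functional n p M (gens_prod n ^ M * detX n ^ p) = int p"
proof -
  let ?U = "var 0 0 * var 1 1"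
  have "0 < p" using assms(2) by simp
  have "target_exp n p M 0 = target_exp n p 0 0 + gens_exp n M"
    by (simp add: target_exp_def gens_exp_def add_ac)
  then have shift: "lookup (gens_prod n ^ M * F * G) (target_exp n p M 0) = lookup (F * G) (target_exp n p 0 0)" for F G
    using lookup_mult_single_add[of "F * G" "gens_exp n M" 1] by (simp add: gens_prod_power mult_ac)
  have "[detX n ^ (p - 1) * ?U ^ p = 0] (below target_exp n p 0 0)"
    using assms by (intro cong_below_zero_if_gvar_power_dvd[of "(1, 1)" p])
      (simp_all add: gvar_def power_mult_distrib lookup_target_exp del: One_nat_def)
  then have lookup_U_power: "lookup (detX n ^ (p - 1) * ?U ^ p) (target_exp n p 0 0) = 0"
    by (simp add: lookup_eq_if_cong_below)
  have "gens_prod n ^ M * detX n ^ p = gens_prod n ^ M * detX n ^ (p - 1) * detX n"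
    using power_minus_mult[OF \<open>0 < p\<close>, of "detX n"] by (simp add: mult.assoc)
  then show ?thesis
    by (simp only: test_functional_mult_detX[OF assms(1) \<open>0 < p\<close>] shift lookup_U_power
        lookup_detX_power_mult_top_minor_power[OF assms(1) \<open>0 < p\<close>] diff_zero)
qed

lemma test_functional_Lambda_detX:
  assumes "3 \<le> n" and "2 \<le> p"
  shows "test_functional n p M (gens_prod n ^ M * Lambda p (detX n)) = 0"
proof -
  obtain s where "Lambda p (detX n) = (\<Sum>g\<in>gens n. s g * gvar g ^ p)"
    using Lambda_detX_in_gvar_powers[of n p] assms(1) by auto
  then have "gens_prod n ^ M * Lambda p (detX n) = (\<Sum>g\<in>gens n. gens_prod n ^ M * gvar g ^ p * s g)"
    by (simp add: sum_distrib_left mult_ac)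
  moreover have "test_functional n p M (gens_prod n ^ M * gvar g ^ p * s g) = 0" if "g \<in> gens n" for g
    using prod_power_dvd[OF finite_gens that, of gvar M p]
    by (intro test_functional_zero_if_gvar_power_dvd[OF assms(2) that]) (rule dvd_mult2)
  ultimately show ?thesis
    by (simp add: additive.sum[OF additive_test_functional])
qed

lemma test_functional_pder_detX:
  assumes "3 \<le> n" and "prime p"
  shows "test_functional n p M (gens_prod n ^ M * pder p (detX n)) = - 1"
    (is "?\<psi> (?f ^ M * _) = _")
proof -
  have "2 \<le> p" using assms(2) by (rule prime_ge_2_nat)
  have "of_nat p * (?f ^ M * pder p (detX n)) = ?f ^ M * (const (int p) * pder p (detX n))"
    by (simp add: const_eq_of_int mult_ac)
  also have "\<dots> = ?f ^ M * Lambda p (detX n) - ?f ^ M * detX n ^ p"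
    by (simp only: const_mult_pder[OF assms(2)] right_diff_distrib)
  finally have "int p * ?\<psi> (?f ^ M * pder p (detX n)) = ?\<psi> (?f ^ M * Lambda p (detX n) - ?f ^ M * detX n ^ p)"
    by (simp flip: additive_mult_of_nat[OF additive_test_functional])
  also have "\<dots> = int p * - 1"
    using assms(1) \<open>2 \<le> p\<close>
    by (simp add: additive.diff[OF additive_test_functional] test_functional_Lambda_detX test_functional_detX_power)
  finally show ?thesis
    using \<open>2 \<le> p\<close> by (subst (asm) mult_cancel_left) simp
qed

lemma pder_detX_class_nonzero_mod_prime:
  assumes "3 \<le> n" and "prime p"
  shows "\<not> cech_top_class_zero (zero_in_R_mod n p) (gens n) gvar (pder p (detX n)) p"
proof (rule cech_top_class_nonzeroI[where \<psi> = "test_functional n p" and d = "int p"])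
  fix M F assume "zero_in_R_mod n p F"
  then obtain b c where "F = b * detX n + of_nat p * c"
    by (auto simp: zero_in_R_mod_def const_eq_of_int mult.commute)
  then show "int p dvd test_functional n p M F"
    using prime_dvd_test_functional_mult_detX[OF assms]
    by (simp add: additive.add[OF additive_test_functional] additive_mult_of_nat[OF additive_test_functional])
next
  fix M
  show "\<not> int p dvd test_functional n p M (gens_prod n ^ M * pder p (detX n))"
    using prime_gt_1_nat[OF assms(2)] assms by (simp add: test_functional_pder_detX)
qed (use prime_ge_2_nat[OF assms(2)] in
    \<open>simp_all add: additive_test_functional test_functional_zero_if_gvar_power_dvd\<close>)

theorem theorem7p1:
  fixes n p :: nat
  assumes "n \<ge> 3" and "prime p"
  shows "\<not> cech_top_class_zero (zero_in_R n) (gens n) gvar (pder p (detX n)) p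
       \<and> cech_top_class_zero (zero_in_R n) (gens n) gvar (const (int p) * pder p (detX n)) p
       \<and> \<not> cech_top_class_zero (zero_in_R_mod n p) (gens n) gvar (pder p (detX n)) p"
proof (intro conjI)
  show nonzero_mod: "\<not> cech_top_class_zero (zero_in_R_mod n p) (gens n) gvar (pder p (detX n)) p"
    using assms by (rule pder_detX_class_nonzero_mod_prime)
  have "zero_in_R_mod n p F" if "zero_in_R n F" for F
    using that unfolding zero_in_R_def zero_in_R_mod_def by (metis add_0_right mult_zero_left)
  then show "\<not> cech_top_class_zero (zero_in_R n) (gens n) gvar (pder p (detX n)) p"
    using nonzero_mod cech_top_class_zero_mono by blast
  show "cech_top_class_zero (zero_in_R n) (gens n) gvar (const (int p) * pder p (detX n)) p"
    using assms by (intro prime_mult_pder_detX_class_zero) auto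
qed

end
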